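(* There are no nontrivial graded coalgebra automorphisms of $\mathrm{QSym}$ that take the monomial basis into itself: if $\varphi:\mathrm{QSym}\to\mathrm{QSym}$ is a graded coalgebra automorphism with $\varphi(\{M_\alpha:\alpha\in\mathcal{C}\})=\{M_\alpha:\alpha\in\mathcal{C}\}$, then $\varphi$ is the identity map.
   Context: A composition is a finite (possibly empty) ordered list $\alpha=(\alpha_1,\dots,\alpha_k)$ of positive integers; $|\alpha|=\alpha_1+\cdots+\alpha_k$, and $\mathcal{C}$ is the set of all compositions ($\emptyset$ is the empty one). $\mathrm{QSym}$ is the set of bounded-degree formal power series $f\in\mathbb{Q}[[x_1,x_2,\dots]]$ such that for each composition $(\alpha_1,\dots,\alpha_k)$ all monomials $x_{i_1}^{\alpha_1}\cdots x_{i_k}^{\alpha_k}$ with $i_1<\cdots<i_k$ have the same coefficient in $f$. The monomial basis is $M_\emptyset=1$, $M_\alpha=\sum_{i_1<\cdots<i_k}x_{i_1}^{\alpha_1}\cdots x_{i_k}^{\alpha_k}$. $\mathrm{QSym}=\bigoplus_{n\ge0}\mathrm{QSym}_n$ with $\mathrm{QSym}_n=\mathrm{span}\{M_\alpha:|\alpha|=n\}$ is a graded coalgebra over $\mathbb{Q}$ with coproduct $\Delta(M_\alpha)=\sum_{\alpha=\beta\cdot\gamma}M_\beta\otimes M_\gamma$ (sum over all ways, empty compositions allowed, of writing $\alpha$ as a concatenation $\beta\cdot\gamma$) and counit $\varepsilon(M_\emptyset)=1$, $\varepsilon(M_\alpha)=0$ for $\alpha\neq\emptyset$. A map is graded if it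 maps $\mathrm{QSym}_n$ into $\mathrm{QSym}_n$ for all $n$. *)

theory Defs
  imports Complex_Main "HOL-Library.Poly_Mapping"
begin

section \<open>Rational vector spaces\<close>

class rat_vector = ab_group_add +
  fixes scaleQ :: "rat \<Rightarrow> 'a \<Rightarrow> 'a"  (infixr \<open>*\<^sub>Q\<close> 75)
  assumes scaleQ_add_right: "c *\<^sub>Q (x + y) = c *\<^sub>Q x + c *\<^sub>Q y"
    and scaleQ_add_left: "(c + d) *\<^sub>Q x = c *\<^sub>Q x + d *\<^sub>Q x"
    and scaleQ_scaleQ: "c *\<^sub>Q d *\<^sub>Q x = (c * d) *\<^sub>Q x"
    and scaleQ_one: "1 *\<^sub>Q x = x"

global_interpretation rat_vector: vector_space "scaleQ :: rat \<Rightarrow> 'a \<Rightarrow> 'a::rat_vector"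
  by unfold_locales (fact scaleQ_add_right scaleQ_add_left scaleQ_scaleQ scaleQ_one)+

abbreviation rat_linear :: "('a::rat_vector \<Rightarrow> 'b::rat_vector) \<Rightarrow> bool"
  where "rat_linear \<equiv> Vector_Spaces.linear scaleQ scaleQ"

lemma rat_linearI:
  fixes h :: "'a::rat_vector \<Rightarrow> 'b::rat_vector"
  assumes "\<And>x y. h (x + y) = h x + h y" "\<And>c x. h (c *\<^sub>Q x) = c *\<^sub>Q h x"
  shows "rat_linear h"
  by unfold_locales (fact assms)+

lemma rat_linear_add: "rat_linear h \<Longrightarrow> h (x + y) = h x + h y"
  by (metis Vector_Spaces.linear.axioms(3) module_hom.add)

lemma rat_linear_scale: "rat_linear h \<Longrightarrow> h (c *\<^sub>Q x) = c *\<^sub>Q h x"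
  by (metis Vector_Spaces.linear.axioms(3) module_hom.scale)

definition rat_bilinear ::
    "('a::rat_vector \<Rightarrow> 'b::rat_vector \<Rightarrow> 'c::rat_vector) \<Rightarrow> bool"
  where "rat_bilinear B \<longleftrightarrow>
    (\<forall>b. rat_linear (\<lambda>a. B a b)) \<and> (\<forall>a. rat_linear (B a))"

instantiation rat :: rat_vector
begin

definition scaleQ_rat :: "rat \<Rightarrow> rat \<Rightarrow> rat"
  where "scaleQ_rat c x = c * x"

instance
  by standard (simp_all add: scaleQ_rat_def algebra_simps)

end


section \<open>Tensor products of rational vector spaces\<close>

text \<open>The tensor product is the quotient of the free rational vector space on all pairs
  by the subspace spanned by the bilinearity relators.\<close>

definition free_scale :: "rat \<Rightarrow> ('k \<Rightarrow>\<^sub>0 rat) \<Rightarrow> ('k \<Rightarrow>\<^sub>0 rat)"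
  where "free_scale c = Poly_Mapping.map ((*) c)"

lemma lookup_free_scale [simp]:
  "Poly_Mapping.lookup (free_scale c s) k = c * Poly_Mapping.lookup s k"
  unfolding free_scale_def by transfer (auto simp: when_def)

global_interpretation free_rat: vector_space free_scale
  by unfold_locales (auto intro!: poly_mapping_eqI simp: lookup_add algebra_simps)

definition pure :: "'a \<Rightarrow> 'b \<Rightarrow> ('a \<times> 'b \<Rightarrow>\<^sub>0 rat)"
  where "pure a b = Poly_Mapping.single (a, b) 1"

definition tensor_relators :: "('a::rat_vector \<times> 'b::rat_vector \<Rightarrow>\<^sub>0 rat) set"
  where "tensor_relators =
    {pure (a + a') b - pure a b - pure a' b | a a' b. True} \<union>
    {pure a (b + b') - pure a b - pure a b' | a b b'. True} \<union>
    {pure (c *\<^sub>Q a) b - free_scale c (pure a b) | c a b. True} \<union>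
    {pure a (c *\<^sub>Q b) - free_scale c (pure a b) | c a b. True}"

definition tensor_rel ::
    "('a::rat_vector \<times> 'b::rat_vector \<Rightarrow>\<^sub>0 rat) \<Rightarrow> ('a \<times> 'b \<Rightarrow>\<^sub>0 rat) \<Rightarrow> bool"
  where "tensor_rel s t \<longleftrightarrow> s - t \<in> free_rat.span tensor_relators"

lemma diff_diff_diff_swap: "(a - b) - (c - d) = (a - c) - (b - d)" for a b c d :: "'k::ab_group_add"
  by (simp add: algebra_simps)

lemma tensor_rel_equivp: "equivp tensor_rel"
proof (rule equivpI)
  show "reflp tensor_rel"
    by (auto simp: reflp_def tensor_rel_def free_rat.span_zero)
  show "symp tensor_rel"
    unfolding symp_def tensor_rel_def
    using free_rat.span_neg by fastforce
  show "transp tensor_rel"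
    unfolding transp_def tensor_rel_def
    using free_rat.span_add by fastforce
qed

quotient_type (overloaded) ('a, 'b) tensor =
  "'a::rat_vector \<times> 'b::rat_vector \<Rightarrow>\<^sub>0 rat" / tensor_rel
  by (rule tensor_rel_equivp)

instantiation tensor :: (rat_vector, rat_vector) rat_vector
begin

lift_definition zero_tensor :: "('a, 'b) tensor" is 0 .

lift_definition plus_tensor :: "('a, 'b) tensor \<Rightarrow> ('a, 'b) tensor \<Rightarrow> ('a, 'b) tensor" is "(+)"
  unfolding tensor_rel_def by (subst add_diff_add) (rule free_rat.span_add)

lift_definition uminus_tensor :: "('a, 'b) tensor \<Rightarrow> ('a, 'b) tensor" is uminus
  unfolding tensor_rel_def by (subst minus_diff_minus) (rule free_rat.span_neg)

lift_definition minus_tensor :: "('a, 'b) tensor \<Rightarrow> ('a, 'b) tensor \<Rightarrow> ('a, 'b) tensor" is "(-)"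
  unfolding tensor_rel_def by (subst diff_diff_diff_swap) (rule free_rat.span_diff)

lift_definition scaleQ_tensor :: "rat \<Rightarrow> ('a, 'b) tensor \<Rightarrow> ('a, 'b) tensor" is free_scale
  unfolding tensor_rel_def
  by (subst free_rat.scale_right_diff_distrib[symmetric]) (rule free_rat.span_scale)

instance
proof
  fix x y z :: "('a, 'b) tensor" and c d :: rat
  have refl: "tensor_rel s s" for s :: "'a \<times> 'b \<Rightarrow>\<^sub>0 rat"
    by (simp add: tensor_rel_def free_rat.span_zero)
  show "x + y + z = x + (y + z)" by transfer (simp add: add.assoc refl)
  show "x + y = y + x" by transfer (simp add: add.commute refl)
  show "0 + x = x" by transfer (simp add: refl)
  show "- x + x = 0" by transfer (simp add: refl)
  show "x - y = x + - y" by transfer (simp add: refl)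
  show "c *\<^sub>Q (x + y) = c *\<^sub>Q x + c *\<^sub>Q y"
    by transfer (simp add: free_rat.scale_right_distrib refl)
  show "(c + d) *\<^sub>Q x = c *\<^sub>Q x + d *\<^sub>Q x"
    by transfer (simp add: free_rat.scale_left_distrib refl)
  show "c *\<^sub>Q d *\<^sub>Q x = (c * d) *\<^sub>Q x"
    by transfer (simp add: refl)
  show "1 *\<^sub>Q x = x"
    by transfer (simp add: refl)
qed

end

lift_definition tensor :: "'a::rat_vector \<Rightarrow> 'b::rat_vector \<Rightarrow> ('a, 'b) tensor"
    (infixl \<open>\<otimes>\<close> 70)
  is pure .

lemma rat_bilinear_tensor:
  "rat_bilinear (tensor :: 'a::rat_vector \<Rightarrow> 'b::rat_vector \<Rightarrow> ('a, 'b) tensor)"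
  unfolding rat_bilinear_def
proof (intro conjI allI; rule rat_linearI)
  fix a a' :: 'a and b b' :: 'b and c :: rat
  show "(a + a') \<otimes> b = a \<otimes> b + a' \<otimes> b"
    by (transfer; unfold tensor_rel_def; rule free_rat.span_base;
        force simp: tensor_relators_def algebra_simps)
  show "(c *\<^sub>Q a) \<otimes> b = c *\<^sub>Q (a \<otimes> b)"
    by (transfer; unfold tensor_rel_def; rule free_rat.span_base; 
        force simp: tensor_relators_def)
  show "a \<otimes> (b + b') = a \<otimes> b + a \<otimes> b'"
    by (transfer; unfold tensor_rel_def; rule free_rat.span_base;
        force simp: tensor_relators_def algebra_simps)
  show "a \<otimes> (c *\<^sub>Q b) = c *\<^sub>Q (a \<otimes> b)"
    by (transfer; unfold tensor_rel_def; rule free_rat.span_base;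
        force simp: tensor_relators_def)
qed

definition free_lift :: "('k \<Rightarrow> 'c::rat_vector) \<Rightarrow> ('k \<Rightarrow>\<^sub>0 rat) \<Rightarrow> 'c"
  where "free_lift g s = (\<Sum>k\<in>Poly_Mapping.keys s. Poly_Mapping.lookup s k *\<^sub>Q g k)"

lemma free_lift_superset:
  assumes "finite K" "Poly_Mapping.keys s \<subseteq> K"
  shows "free_lift g s = (\<Sum>k\<in>K. Poly_Mapping.lookup s k *\<^sub>Q g k)"
  unfolding free_lift_def
  by (rule sum.mono_neutral_left) (use assms in \<open>auto simp: in_keys_iff\<close>)

lemma free_lift_add: "free_lift g (s + t) = free_lift g s + free_lift g t"
proof -
  let ?K = "Poly_Mapping.keys s \<union> Poly_Mapping.keys t"
  have "free_lift g (s + t) = (\<Sum>k\<in>?K. Poly_Mapping.lookup (s + t) k *\<^sub>Q g k)"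
    by (rule free_lift_superset) (auto simp: in_keys_iff lookup_add)
  also have "\<dots> = (\<Sum>k\<in>?K. Poly_Mapping.lookup s k *\<^sub>Q g k)
      + (\<Sum>k\<in>?K. Poly_Mapping.lookup t k *\<^sub>Q g k)"
    by (simp add: lookup_add scaleQ_add_left sum.distrib)
  finally show ?thesis
    by (simp add: free_lift_superset[of ?K s] free_lift_superset[of ?K t])
qed

lemma free_lift_scale: "free_lift g (free_scale c s) = c *\<^sub>Q free_lift g s"
proof -
  have "free_lift g (free_scale c s)
      = (\<Sum>k\<in>Poly_Mapping.keys s. Poly_Mapping.lookup (free_scale c s) k *\<^sub>Q g k)"
    by (rule free_lift_superset) (auto simp: in_keys_iff)
  then show ?thesis
    by (simp add: free_lift_def rat_vector.scale_sum_right)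
qed

lemma free_lift_diff: "free_lift g (s - t) = free_lift g s - free_lift g t"
  using free_lift_add[of g "s - t" t] by (simp add: algebra_simps)

lemma free_lift_pure [simp]: "free_lift g (pure a b) = g (a, b)"
  by (simp add: free_lift_def pure_def)

text \<open>The factorization of a bilinear map \<open>B\<close> through the tensor product: it is evaluated on an
  arbitrary representative, which is meaningful only for bilinear \<open>B\<close>.\<close>

definition tensor_lift ::
    "('a::rat_vector \<Rightarrow> 'b::rat_vector \<Rightarrow> 'c::rat_vector) \<Rightarrow> ('a, 'b) tensor \<Rightarrow> 'c"
  where "tensor_lift B t = free_lift (\<lambda>(a, b). B a b) (rep_tensor t)"

lemma tensor_lift_abs:
  assumes "rat_bilinear B"
  shows "tensor_lift B (abs_tensor s) = free_lift (\<lambda>(a, b). B a b) s"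
proof -
  let ?L = "free_lift (\<lambda>(a, b). B a b)"
  have B: "B (a + a') b = B a b + B a' b" "B (c *\<^sub>Q a) b = c *\<^sub>Q B a b"
      "B a (b + b') = B a b + B a b'" "B a (c *\<^sub>Q b) = c *\<^sub>Q B a b" for a a' b b' c
    using assms
      rat_linear_add[of "\<lambda>a. B a b" a a'] rat_linear_scale[of "\<lambda>a. B a b" c a]
      rat_linear_add[of "B a" b b'] rat_linear_scale[of "B a" c b]
    by (simp_all add: rat_bilinear_def)
  have zero: "?L s = 0" if "s \<in> free_rat.span tensor_relators" for s
    using that
  proof (induction rule: free_rat.span_induct_alt)
    case base
    then show ?case by (simp add: free_lift_def)
  next
    case (step c x y)
    have "?L x = 0"
      using step.hyps
      by (auto simp: tensor_relators_def free_lift_diff free_lift_scale B)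
    then show ?case
      by (simp add: free_lift_add free_lift_scale step.IH)
  qed
  have "tensor_rel (rep_tensor (abs_tensor s)) s"
    by (metis Quotient3_rep_abs Quotient3_tensor tensor_rel_equivp equivp_reflp)
  then have "?L (rep_tensor (abs_tensor s) - s) = 0"
    unfolding tensor_rel_def by (rule zero)
  then show ?thesis
    by (simp add: tensor_lift_def free_lift_diff)
qed

lemma tensor_lift_tensor:
  assumes "rat_bilinear B"
  shows "tensor_lift B (a \<otimes> b) = B a b"
  using tensor_lift_abs[OF assms, of "pure a b"] by (simp add: tensor.abs_eq)

lemma rat_linear_tensor_lift:
  assumes "rat_bilinear B"
  shows "rat_linear (tensor_lift B)"
proof (rule rat_linearI)
  fix x y :: "('a, 'b) tensor" and c :: rat
  obtain s t where st: "x = abs_tensor s" "y = abs_tensor t"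
    by (metis Quotient3_abs_rep Quotient3_tensor)
  show "tensor_lift B (x + y) = tensor_lift B x + tensor_lift B y"
    by (simp add: st plus_tensor.abs_eq tensor_lift_abs[OF assms] free_lift_add)
  show "tensor_lift B (c *\<^sub>Q x) = c *\<^sub>Q tensor_lift B x"
    by (simp add: st scaleQ_tensor.abs_eq tensor_lift_abs[OF assms] free_lift_scale)
qed

definition tensor_map ::
    "('a::rat_vector \<Rightarrow> 'c::rat_vector) \<Rightarrow> ('b::rat_vector \<Rightarrow> 'd::rat_vector) \<Rightarrow>
      ('a, 'b) tensor \<Rightarrow> ('c, 'd) tensor"
  where "tensor_map f g = tensor_lift (\<lambda>a b. f a \<otimes> g b)"

lemma rat_bilinear_tensor_map:
  assumes "rat_linear f" "rat_linear g"
  shows "rat_bilinear (\<lambda>a b. f a \<otimes> g b)"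
proof -
  have "(x + x') \<otimes> y = x \<otimes> y + x' \<otimes> y" "(c *\<^sub>Q x) \<otimes> y = c *\<^sub>Q (x \<otimes> y)"
    "x \<otimes> (y + y') = x \<otimes> y + x \<otimes> y'" "x \<otimes> (c *\<^sub>Q y) = c *\<^sub>Q (x \<otimes> y)"
    for x x' :: 'b and y y' :: 'd and c
    using rat_bilinear_tensor[where 'a='b and 'b='d]
      rat_linear_add[of "\<lambda>a. a \<otimes> y" x x'] rat_linear_scale[of "\<lambda>a. a \<otimes> y" c x]
      rat_linear_add[of "tensor x" y y'] rat_linear_scale[of "tensor x" c y]
    by (simp_all add: rat_bilinear_def)
  then show ?thesis
    unfolding rat_bilinear_def
    by (auto intro!: rat_linearI simp: rat_linear_add[OF assms(1)] rat_linear_add[OF assms(2)]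
        rat_linear_scale[OF assms(1)] rat_linear_scale[OF assms(2)])
qed

lemma tensor_map_tensor:
  "rat_linear f \<Longrightarrow> rat_linear g \<Longrightarrow> tensor_map f g (a \<otimes> b) = f a \<otimes> g b"
  by (simp add: tensor_map_def tensor_lift_tensor rat_bilinear_tensor_map)

lemma rat_linear_tensor_map:
  "rat_linear f \<Longrightarrow> rat_linear g \<Longrightarrow> rat_linear (tensor_map f g)"
  by (simp add: tensor_map_def rat_linear_tensor_lift rat_bilinear_tensor_map)


section \<open>Compositions and quasisymmetric functions\<close>

definition compositions :: "nat list set"
  where "compositions = {\<alpha>. \<forall>a\<in>set \<alpha>. 0 < a}"

text \<open>A monomial is its exponent vector; the variables are indexed from 0.
  \<open>xpow is \<alpha>\<close> is the monomial with exponent \<open>\<alpha> ! j\<close> at the variable \<open>is ! j\<close>.\<close>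

definition xpow :: "nat list \<Rightarrow> nat list \<Rightarrow> (nat \<Rightarrow>\<^sub>0 nat)"
  where "xpow is \<alpha> = (\<Sum>j<length \<alpha>. Poly_Mapping.single (is ! j) (\<alpha> ! j))"

definition total_degree :: "(nat \<Rightarrow>\<^sub>0 nat) \<Rightarrow> nat"
  where "total_degree m = (\<Sum>i\<in>Poly_Mapping.keys m. Poly_Mapping.lookup m i)"

definition bounded_degree :: "((nat \<Rightarrow>\<^sub>0 nat) \<Rightarrow> rat) \<Rightarrow> bool"
  where "bounded_degree f \<longleftrightarrow> (\<exists>d. \<forall>m. f m \<noteq> 0 \<longrightarrow> total_degree m \<le> d)"

definition increasing_indices :: "nat list \<Rightarrow> nat list set"
  where "increasing_indices \<alpha> = {is. length is = length \<alpha> \<and> sorted_wrt (<) is}"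

definition quasisymmetric :: "((nat \<Rightarrow>\<^sub>0 nat) \<Rightarrow> rat) \<Rightarrow> bool"
  where "quasisymmetric f \<longleftrightarrow>
    (\<forall>\<alpha>\<in>compositions. \<forall>is\<in>increasing_indices \<alpha>. \<forall>js\<in>increasing_indices \<alpha>.
      f (xpow is \<alpha>) = f (xpow js \<alpha>))"

typedef qsym = "{f :: (nat \<Rightarrow>\<^sub>0 nat) \<Rightarrow> rat. bounded_degree f \<and> quasisymmetric f}"
  morphisms coeff_qsym Abs_qsym
  by (rule exI[of _ "\<lambda>_. 0"]) (simp add: bounded_degree_def quasisymmetric_def)

setup_lifting type_definition_qsym

lemma qsym_combine:
  assumes f: "bounded_degree f \<and> quasisymmetric f" and g: "bounded_degree g \<and> quasisymmetric g"
    and F: "F 0 0 = 0"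
  shows "bounded_degree (\<lambda>m. F (f m) (g m)) \<and> quasisymmetric (\<lambda>m. F (f m) (g m))"
proof
  obtain d e where de: "\<forall>m. f m \<noteq> 0 \<longrightarrow> total_degree m \<le> d"
      "\<forall>m. g m \<noteq> 0 \<longrightarrow> total_degree m \<le> e"
    using f g unfolding bounded_degree_def by blast
  have "total_degree m \<le> max d e" if "F (f m) (g m) \<noteq> 0" for m
    using that F de by (metis le_max_iff_disj)
  then show "bounded_degree (\<lambda>m. F (f m) (g m))" unfolding bounded_degree_def by blast
  show "quasisymmetric (\<lambda>m. F (f m) (g m))"
    using f g unfolding quasisymmetric_def by metis
qed

instantiation qsym :: rat_vector
begin

lift_definition zero_qsym :: qsym is "\<lambda>_. 0"
  by (simp add: bounded_degree_def quasisymmetric_def)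

lift_definition plus_qsym :: "qsym \<Rightarrow> qsym \<Rightarrow> qsym" is "\<lambda>f g m. f m + g m"
  by (rule qsym_combine) auto

lift_definition minus_qsym :: "qsym \<Rightarrow> qsym \<Rightarrow> qsym" is "\<lambda>f g m. f m - g m"
  by (rule qsym_combine) auto

lift_definition uminus_qsym :: "qsym \<Rightarrow> qsym" is "\<lambda>f m. - f m"
  by (rule qsym_combine[where F = "\<lambda>a b. - a"]) auto

lift_definition scaleQ_qsym :: "rat \<Rightarrow> qsym \<Rightarrow> qsym" is "\<lambda>c f m. c * f m"
  by (rule qsym_combine[where F = "\<lambda>a b. c * a" for c]) auto

instance
  by standard (transfer; simp add: algebra_simps fun_eq_iff)+

end

text \<open>As the parts are positive, distinct increasing index sequences give distinct monomials,
  so every coefficient of the formal sum \<open>M \<alpha>\<close> is 0 or 1. Only \<open>\<alpha> \<in> compositions\<close> is meaningful.\<close>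

definition M :: "nat list \<Rightarrow> qsym"
  where "M \<alpha> = Abs_qsym (\<lambda>m. of_bool (m \<in> (\<lambda>is. xpow is \<alpha>) ` increasing_indices \<alpha>))"

lemma xpow_notin:
  assumes "i \<notin> set is" "length is = length \<alpha>"
  shows "Poly_Mapping.lookup (xpow is \<alpha>) i = 0"
  using assms by (auto simp: xpow_def lookup_sum lookup_single_not_eq intro!: sum.neutral)
    (metis lookup_single_not_eq nth_mem)

lemma xpow_nth:
  assumes "is \<in> increasing_indices \<alpha>" "j < length \<alpha>"
  shows "Poly_Mapping.lookup (xpow is \<alpha>) (is ! j) = \<alpha> ! j"
proof -
  have len: "length is = length \<alpha>" and d: "distinct is"
    using assms(1) by (auto simp: increasing_indices_def strict_sorted_iff)
  have "Poly_Mapping.lookup (xpow is \<alpha>) (is ! j)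
      = (\<Sum>i<length \<alpha>. if i = j then \<alpha> ! j else 0)"
    unfolding xpow_def lookup_sum
    by (rule sum.cong)
      (use len d assms(2) in \<open>auto simp: lookup_single nth_eq_iff_index_eq when_def\<close>)
  then show ?thesis using assms(2) by simp
qed

lemma keys_xpow:
  assumes "is \<in> increasing_indices \<alpha>" "\<alpha> \<in> compositions"
  shows "Poly_Mapping.keys (xpow is \<alpha>) = set is"
proof -
  have len: "length is = length \<alpha>" using assms(1) by (simp add: increasing_indices_def)
  have "Poly_Mapping.lookup (xpow is \<alpha>) i \<noteq> 0" if "i \<in> set is" for i
  proof -
    obtain j where j: "j < length \<alpha>" "i = is ! j"
      using \<open>i \<in> set is\<close> len by (metis in_set_conv_nth)
    have "0 < \<alpha> ! j" using assms(2) j(1) by (simp add: compositions_def)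
    then show ?thesis using xpow_nth[OF assms(1) j(1)] j(2) by simp
  qed
  then show ?thesis
    using xpow_notin[OF _ len] by (auto simp: in_keys_iff)
qed

lemma xpow_inject:
  assumes "is \<in> increasing_indices \<alpha>" "\<alpha> \<in> compositions"
    and "js \<in> increasing_indices \<beta>" "\<beta> \<in> compositions"
    and eq: "xpow is \<alpha> = xpow js \<beta>"
  shows "is = js \<and> \<alpha> = \<beta>"
proof -
  have "set is = set js" using keys_xpow[OF assms(1,2)] keys_xpow[OF assms(3,4)] eq by simp
  then have ij: "is = js"
    using assms(1,3) by (auto simp: increasing_indices_def intro: strict_sorted_equal)
  have len: "length \<alpha> = length \<beta>"
    using assms(1,3) ij by (simp add: increasing_indices_def)
  have "\<alpha> = \<beta>"
    by (rule nth_equalityI[OF len]) (metis assms(1,3) eq ij len xpow_nth)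
  with ij show ?thesis ..
qed

lemma total_degree_xpow:
  assumes "is \<in> increasing_indices \<alpha>" "\<alpha> \<in> compositions"
  shows "total_degree (xpow is \<alpha>) = sum_list \<alpha>"
proof -
  have len: "length is = length \<alpha>" and d: "distinct is"
    using assms(1) by (auto simp: increasing_indices_def strict_sorted_iff)
  have "total_degree (xpow is \<alpha>) = (\<Sum>i\<in>set is. Poly_Mapping.lookup (xpow is \<alpha>) i)"
    by (simp add: total_degree_def keys_xpow[OF assms])
  also have "\<dots> = (\<Sum>i\<leftarrow>is. Poly_Mapping.lookup (xpow is \<alpha>) i)"
    by (simp add: sum_list_distinct_conv_sum_set[OF d])
  also have "map (\<lambda>i. Poly_Mapping.lookup (xpow is \<alpha>) i) is = \<alpha>"
    by (rule nth_equalityI) (use len xpow_nth[OF assms(1)] in auto)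
  finally show ?thesis .
qed

lemma coeff_M:
  assumes "\<alpha> \<in> compositions"
  shows "coeff_qsym (M \<alpha>) = (\<lambda>m. of_bool (m \<in> (\<lambda>is. xpow is \<alpha>) ` increasing_indices \<alpha>))"
proof -
  let ?f = "\<lambda>m. of_bool (m \<in> (\<lambda>is. xpow is \<alpha>) ` increasing_indices \<alpha>) :: rat"
  have "bounded_degree ?f"
    unfolding bounded_degree_def
    by (rule exI[of _ "sum_list \<alpha>"]) (auto simp: total_degree_xpow assms)
  moreover have "quasisymmetric ?f"
    unfolding quasisymmetric_def
  proof (intro ballI)
    fix \<beta> "is" js
    assume *: "\<beta> \<in> compositions" "is \<in> increasing_indices \<beta>" "js \<in> increasing_indices \<beta>"
    have "xpow ks \<beta> \<in> (\<lambda>is. xpow is \<alpha>) ` increasing_indices \<alpha> \<longleftrightarrow> \<beta> = \<alpha>"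
      if "ks \<in> increasing_indices \<beta>" for ks
      using xpow_inject[OF that *(1) _ assms] that by blast
    then show "?f (xpow is \<beta>) = ?f (xpow js \<beta>)" using * by simp
  qed
  ultimately show ?thesis
    unfolding M_def by (simp add: Abs_qsym_inverse)
qed

definition QSym_n :: "nat \<Rightarrow> qsym set"
  where "QSym_n n = rat_vector.span {M \<alpha> | \<alpha>. \<alpha> \<in> compositions \<and> sum_list \<alpha> = n}"

text \<open>The common coefficient in \<open>f\<close> of the monomials attached to the composition \<open>\<alpha>\<close>, that is,
  the coefficient of \<open>M \<alpha>\<close> in the expansion of \<open>f\<close> in the monomial basis.\<close>

definition qcoeff :: "qsym \<Rightarrow> nat list \<Rightarrow> rat"
  where "qcoeff f \<alpha> = coeff_qsym f (xpow [0..<length \<alpha>] \<alpha>)"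

lemma upt_increasing: "[0..<length \<alpha>] \<in> increasing_indices \<alpha>"
  by (simp add: increasing_indices_def)

lemma qcoeff_eq:
  assumes "\<alpha> \<in> compositions" "is \<in> increasing_indices \<alpha>"
  shows "coeff_qsym f (xpow is \<alpha>) = qcoeff f \<alpha>"
  using coeff_qsym[of f] assms upt_increasing[of \<alpha>]
  unfolding qcoeff_def quasisymmetric_def by blast

lemma qcoeff_M:
  assumes "\<alpha> \<in> compositions" "\<beta> \<in> compositions"
  shows "qcoeff (M \<alpha>) \<beta> = of_bool (\<alpha> = \<beta>)"
  unfolding qcoeff_def coeff_M[OF assms(1)]
  using xpow_inject[OF upt_increasing assms(2) _ assms(1)] upt_increasing by auto

lemma finite_qcoeff: "finite {\<alpha> \<in> compositions. qcoeff f \<alpha> \<noteq> 0}"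
proof -
  obtain d where d: "\<forall>m. coeff_qsym f m \<noteq> 0 \<longrightarrow> total_degree m \<le> d"
    using coeff_qsym[of f] by (auto simp: bounded_degree_def)
  have "{\<alpha> \<in> compositions. qcoeff f \<alpha> \<noteq> 0} \<subseteq> {xs. set xs \<subseteq> {..d} \<and> length xs \<le> d}"
  proof
    fix \<alpha> assume "\<alpha> \<in> {\<alpha> \<in> compositions. qcoeff f \<alpha> \<noteq> 0}"
    then have \<alpha>: "\<alpha> \<in> compositions" "qcoeff f \<alpha> \<noteq> 0" by auto
    then have s: "sum_list \<alpha> \<le> d"
      using d total_degree_xpow[OF upt_increasing \<alpha>(1)] by (metis qcoeff_def)
    have "length \<alpha> \<le> sum_list \<alpha>"
      using \<alpha>(1) by (induction \<alpha>) (auto simp: compositions_def)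
    moreover have "a \<le> sum_list \<alpha>" if "a \<in> set \<alpha>" for a
      using that by (rule member_le_sum_list) simp_all
    ultimately show "\<alpha> \<in> {xs. set xs \<subseteq> {..d} \<and> length xs \<le> d}" using s by force
  qed
  then show ?thesis
    by (rule finite_subset) (simp add: finite_lists_length_le)
qed

text \<open>The linear extension of a map given on the monomial basis; the sum is finite
  because \<open>f\<close> has bounded degree.\<close>

definition M_extend :: "(nat list \<Rightarrow> 'a::rat_vector) \<Rightarrow> qsym \<Rightarrow> 'a"
  where "M_extend g f = (\<Sum>\<alpha> | \<alpha> \<in> compositions \<and> qcoeff f \<alpha> \<noteq> 0. qcoeff f \<alpha> *\<^sub>Q g \<alpha>)"

lemma M_extend_superset:
  assumes "finite A" "{\<alpha> \<in> compositions. qcoeff f \<alpha> \<noteq> 0} \<subseteq> A" "A \<subseteq> compositions"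
  shows "M_extend g f = (\<Sum>\<alpha>\<in>A. qcoeff f \<alpha> *\<^sub>Q g \<alpha>)"
  unfolding M_extend_def
  by (rule sum.mono_neutral_left) (use assms in auto)

lemma qcoeff_add: "qcoeff (f + g) \<alpha> = qcoeff f \<alpha> + qcoeff g \<alpha>"
  by (simp add: qcoeff_def plus_qsym.rep_eq)

lemma qcoeff_scale: "qcoeff (c *\<^sub>Q f) \<alpha> = c * qcoeff f \<alpha>"
  by (simp add: qcoeff_def scaleQ_qsym.rep_eq)

lemma rat_linear_M_extend: "rat_linear (M_extend g)"
proof (rule rat_linearI)
  fix x y :: qsym and c :: rat
  let ?S = "\<lambda>f. {\<alpha> \<in> compositions. qcoeff f \<alpha> \<noteq> 0}"
  let ?A = "?S x \<union> ?S y"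
  have A: "finite ?A" "?A \<subseteq> compositions" using finite_qcoeff by auto
  have e: "M_extend g f = (\<Sum>\<alpha>\<in>?A. qcoeff f \<alpha> *\<^sub>Q g \<alpha>)" if "?S f \<subseteq> ?A" for f
    using M_extend_superset[OF A(1) that A(2)] .
  show "M_extend g (x + y) = M_extend g x + M_extend g y"
    by (subst (1 2 3) e) (auto simp: qcoeff_add scaleQ_add_left sum.distrib)
  show "M_extend g (c *\<^sub>Q x) = c *\<^sub>Q M_extend g x"
    by (subst (1 2) e) (auto simp: qcoeff_scale rat_vector.scale_sum_right)
qed

lemma M_extend_M:
  assumes "\<alpha> \<in> compositions"
  shows "M_extend g (M \<alpha>) = g \<alpha>"
proof -
  have "M_extend g (M \<alpha>) = (\<Sum>\<beta>\<in>{\<alpha>}. qcoeff (M \<alpha>) \<beta> *\<^sub>Q g \<beta>)"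
    by (rule M_extend_superset) (use assms in \<open>auto simp: qcoeff_M\<close>)
  then show ?thesis using assms by (simp add: qcoeff_M)
qed

lemma monomial_eq_xpow: "\<exists>\<alpha>\<in>compositions. \<exists>is\<in>increasing_indices \<alpha>. m = xpow is \<alpha>"
proof -
  define "is" where "is = sorted_list_of_set (Poly_Mapping.keys m)"
  define \<alpha> where "\<alpha> = map (Poly_Mapping.lookup m) is"
  have set: "set is = Poly_Mapping.keys m" by (simp add: is_def)
  have \<alpha>: "\<alpha> \<in> compositions"
    by (auto simp: compositions_def \<alpha>_def set in_keys_iff)
  have inc: "is \<in> increasing_indices \<alpha>"
    by (simp add: increasing_indices_def \<alpha>_def is_def)
  have "m = xpow is \<alpha>"
  proof (rule poly_mapping_eqI)
    fix i
    show "Poly_Mapping.lookup m i = Poly_Mapping.lookup (xpow is \<alpha>) i"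
    proof (cases "i \<in> set is")
      case True
      then obtain j where j: "j < length \<alpha>" "i = is ! j"
        by (auto simp: in_set_conv_nth \<alpha>_def)
      then show ?thesis
        using xpow_nth[OF inc j(1)] by (simp add: \<alpha>_def)
    next
      case False
      then have "Poly_Mapping.lookup (xpow is \<alpha>) i = 0"
        by (rule xpow_notin) (simp add: \<alpha>_def)
      then show ?thesis using False set by (simp add: in_keys_iff)
    qed
  qed
  with \<alpha> inc show ?thesis by blast
qed

lemma qsym_eqI:
  assumes "\<And>\<alpha>. \<alpha> \<in> compositions \<Longrightarrow> qcoeff f \<alpha> = qcoeff g \<alpha>"
  shows "f = g"
proof -
  have "coeff_qsym f m = coeff_qsym g m" for m
    using monomial_eq_xpow[of m] assms by (auto simp: qcoeff_eq)
  then show ?thesis by (simp add: coeff_qsym_inject[symmetric] fun_eq_iff)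
qed

lemma rat_linear_qcoeff: "rat_linear (\<lambda>f. qcoeff f \<alpha>)"
  by (rule rat_linearI) (simp_all add: qcoeff_add qcoeff_scale scaleQ_rat_def)

lemma qcoeff_sum: "qcoeff (\<Sum>x\<in>A. h x) \<alpha> = (\<Sum>x\<in>A. qcoeff (h x) \<alpha>)"
proof (induction A rule: infinite_finite_induct)
  case (insert x A)
  then show ?case by (simp add: qcoeff_add)
qed (simp_all add: qcoeff_def zero_qsym.rep_eq)

lemma qsym_expand: "f = (\<Sum>\<alpha> | \<alpha> \<in> compositions \<and> qcoeff f \<alpha> \<noteq> 0. qcoeff f \<alpha> *\<^sub>Q M \<alpha>)"
proof (rule qsym_eqI)
  fix \<beta> assume \<beta>: "\<beta> \<in> compositions"
  let ?S = "{\<alpha> \<in> compositions. qcoeff f \<alpha> \<noteq> 0}"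
  have "qcoeff (\<Sum>\<alpha>\<in>?S. qcoeff f \<alpha> *\<^sub>Q M \<alpha>) \<beta> = (\<Sum>\<alpha>\<in>?S. if \<alpha> = \<beta> then qcoeff f \<alpha> else 0)"
    unfolding qcoeff_sum qcoeff_scale
    by (rule sum.cong) (auto simp: qcoeff_M \<beta>)
  also have "\<dots> = qcoeff f \<beta>"
    using finite_qcoeff[of f] \<beta> by (simp add: sum.delta')
  finally show "qcoeff f \<beta> = qcoeff (\<Sum>\<alpha>\<in>?S. qcoeff f \<alpha> *\<^sub>Q M \<alpha>) \<beta>" ..
qed

definition coproduct :: "qsym \<Rightarrow> (qsym, qsym) tensor"
  where "coproduct = M_extend (\<lambda>\<alpha>. \<Sum>(\<beta>, \<gamma>) | \<beta> @ \<gamma> = \<alpha>. M \<beta> \<otimes> M \<gamma>)"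

definition counit :: "qsym \<Rightarrow> rat"
  where "counit = M_extend (\<lambda>\<alpha>. if \<alpha> = [] then 1 else 0)"

lemma coproduct_M:
  "\<alpha> \<in> compositions \<Longrightarrow> coproduct (M \<alpha>) = (\<Sum>(\<beta>, \<gamma>) | \<beta> @ \<gamma> = \<alpha>. M \<beta> \<otimes> M \<gamma>)"
  by (simp add: coproduct_def M_extend_M)

lemma finite_deconcatenations: "finite {(\<beta>, \<gamma>). \<beta> @ \<gamma> = \<alpha>}"
proof (rule finite_subset)
  show "{(\<beta>, \<gamma>). \<beta> @ \<gamma> = \<alpha>} \<subseteq> (\<lambda>i. (take i \<alpha>, drop i \<alpha>)) ` {..length \<alpha>}"
  proof clarify
    fix \<beta> \<gamma>
    show "(\<beta>, \<gamma>) \<in> (\<lambda>i. (take i (\<beta> @ \<gamma>), drop i (\<beta> @ \<gamma>))) ` {..length (\<beta> @ \<gamma>)}"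
      by (rule image_eqI[of _ _ "length \<beta>"]) auto
  qed
qed simp

lemma counit_M: "\<alpha> \<in> compositions \<Longrightarrow> counit (M \<alpha>) = (if \<alpha> = [] then 1 else 0)"
  by (simp add: counit_def M_extend_M)


section \<open>Graded coalgebra automorphisms\<close>

definition coalgebra_automorphism ::
    "('a::rat_vector \<Rightarrow> ('a, 'a) tensor) \<Rightarrow> ('a \<Rightarrow> rat) \<Rightarrow> ('a \<Rightarrow> 'a) \<Rightarrow> bool"
  where "coalgebra_automorphism \<Delta> \<epsilon> \<phi> \<longleftrightarrow>
    rat_linear \<phi> \<and> bij \<phi> \<and>
    (\<forall>x. \<Delta> (\<phi> x) = tensor_map \<phi> \<phi> (\<Delta> x)) \<and>
    (\<forall>x. \<epsilon> (\<phi> x) = \<epsilon> x)"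

definition graded_map :: "(qsym \<Rightarrow> qsym) \<Rightarrow> bool"
  where "graded_map \<phi> \<longleftrightarrow> (\<forall>n. \<phi> ` QSym_n n \<subseteq> QSym_n n)"

end

theory Submission
  imports Defs
begin

text \<open>
  The map \<open>\<phi>\<close> permutes the basis, so \<open>\<phi> (M \<alpha>) = M (\<sigma> \<alpha>)\<close> for some map \<open>\<sigma>\<close> on compositions,
  which preserves the size \<open>sum_list \<alpha>\<close> because \<open>\<phi>\<close> is graded. As the tensors \<open>M \<beta> \<otimes> M \<gamma>\<close> are
  linearly independent, comparing coefficients in \<open>\<Delta> (\<phi> (M \<alpha>)) = (\<phi> \<otimes> \<phi>) (\<Delta> (M \<alpha>))\<close> shows that
  the ways of writing \<open>\<sigma> \<alpha>\<close> as \<open>\<beta> @ \<gamma>\<close> are exactly the images under \<open>\<sigma>\<close> of those of \<open>\<alpha>\<close>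
  (\<open>deconcatenation_image\<close>).

  This determines \<open>\<sigma>\<close>. A one-part composition \<open>[a]\<close> has no deconcatenation into two nonempty
  pieces, so \<open>\<sigma> [a]\<close> has none either, and by size it is \<open>[a]\<close>; in other words, \<open>M [a]\<close> is the
  only primitive basis element of degree \<open>a > 0\<close>. Induction on the number of parts now gives
  \<open>\<sigma> (a # \<gamma>) = \<sigma> [a] @ \<sigma> \<gamma> = a # \<gamma>\<close> (\<open>deconcatenation_map_is_identity\<close>). Hence \<open>\<phi>\<close> fixes the
  basis and is the identity.
\<close>

lemma rat_linear_sum: "rat_linear h \<Longrightarrow> h (\<Sum>x\<in>A. f x) = (\<Sum>x\<in>A. h (f x))"
  by (metis Vector_Spaces.linear.axioms(3) module_hom.sum)

lemma Nil_in_compositions [simp]: "[] \<in> compositions"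
  by (simp add: compositions_def)

lemma Cons_in_compositions [simp]: "a # \<alpha> \<in> compositions \<longleftrightarrow> 0 < a \<and> \<alpha> \<in> compositions"
  by (auto simp: compositions_def)

lemma append_in_compositions [simp]:
  "\<beta> @ \<gamma> \<in> compositions \<longleftrightarrow> \<beta> \<in> compositions \<and> \<gamma> \<in> compositions"
  by (auto simp: compositions_def)

lemma composition_sum_eq_0: "\<alpha> \<in> compositions \<Longrightarrow> sum_list \<alpha> = 0 \<Longrightarrow> \<alpha> = []"
  by (cases \<alpha>) auto

lemma M_in_QSym_n: "\<alpha> \<in> compositions \<Longrightarrow> M \<alpha> \<in> QSym_n (sum_list \<alpha>)"
  unfolding QSym_n_def by (rule rat_vector.span_base) blast

lemma qcoeff_other_degree:
  assumes "f \<in> QSym_n n" "\<beta> \<in> compositions" "sum_list \<beta> \<noteq> n"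
  shows "qcoeff f \<beta> = 0"
  using assms(1) unfolding QSym_n_def
proof (induction rule: rat_vector.span_induct_alt)
  case base
  then show ?case by (simp add: qcoeff_def zero_qsym.rep_eq)
next
  case (step c x y)
  then show ?case
    using assms(2,3) by (auto simp: qcoeff_add qcoeff_scale qcoeff_M)
qed

lemma M_in_QSym_n_iff:
  assumes "\<alpha> \<in> compositions"
  shows "M \<alpha> \<in> QSym_n n \<longleftrightarrow> sum_list \<alpha> = n"
  using M_in_QSym_n[OF assms] qcoeff_other_degree[of "M \<alpha>" n \<alpha>] assms by (auto simp: qcoeff_M)

lemma rat_linear_eq_id_if_fixes_M:
  assumes "rat_linear h" "\<And>\<alpha>. \<alpha> \<in> compositions \<Longrightarrow> h (M \<alpha>) = M \<alpha>"
  shows "h = id"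
proof
  fix f
  let ?S = "{\<alpha> \<in> compositions. qcoeff f \<alpha> \<noteq> 0}"
  have "h f = h (\<Sum>\<alpha>\<in>?S. qcoeff f \<alpha> *\<^sub>Q M \<alpha>)" using qsym_expand[of f] by simp
  also have "\<dots> = (\<Sum>\<alpha>\<in>?S. qcoeff f \<alpha> *\<^sub>Q M \<alpha>)"
    by (simp add: rat_linear_sum[OF assms(1)] rat_linear_scale[OF assms(1)] assms(2))
  also have "\<dots> = f" using qsym_expand[of f] by simp
  finally show "h f = id f" by simp
qed

text \<open>The functional \<open>qcoeff _ \<beta> \<otimes> qcoeff _ \<gamma>\<close> on the tensor square. On the tensors
  \<open>M \<beta>' \<otimes> M \<gamma>'\<close> these functionals take the values of the dual basis, which makes comparing
  coefficients in the tensor square legitimate.\<close>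

definition tensor_coeff :: "nat list \<Rightarrow> nat list \<Rightarrow> (qsym, qsym) tensor \<Rightarrow> rat"
  where "tensor_coeff \<beta> \<gamma> = tensor_lift (\<lambda>f g. qcoeff f \<beta> * qcoeff g \<gamma>)"

lemma rat_bilinear_qcoeff_mult: "rat_bilinear (\<lambda>f g. qcoeff f \<beta> * qcoeff g \<gamma>)"
  unfolding rat_bilinear_def
  by (auto intro!: rat_linearI simp: qcoeff_add qcoeff_scale scaleQ_rat_def algebra_simps)

lemma rat_linear_tensor_coeff: "rat_linear (tensor_coeff \<beta> \<gamma>)"
  unfolding tensor_coeff_def by (rule rat_linear_tensor_lift[OF rat_bilinear_qcoeff_mult])

lemma tensor_coeff_M:
  assumes "\<beta> \<in> compositions" "\<gamma> \<in> compositions" "\<beta>' \<in> compositions" "\<gamma>' \<in> compositions"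
  shows "tensor_coeff \<beta> \<gamma> (M \<beta>' \<otimes> M \<gamma>') = of_bool (\<beta>' = \<beta> \<and> \<gamma>' = \<gamma>)"
  using assms
  by (simp add: tensor_coeff_def tensor_lift_tensor[OF rat_bilinear_qcoeff_mult] qcoeff_M)

text \<open>The coefficient at \<open>M \<beta> \<otimes> M \<gamma>\<close> counts the deconcatenations of \<open>\<alpha>\<close> that \<open>\<sigma>\<close> sends to
  \<open>(\<beta>, \<gamma>)\<close>; each contributes 1, so nothing cancels and it vanishes only if there are none.
  For \<open>\<sigma> = id\<close> this describes the coproduct of a basis element itself.\<close>

lemma tensor_coeff_deconcatenations:
  assumes "\<alpha> \<in> compositions" "\<beta> \<in> compositions" "\<gamma> \<in> compositions"
    and "\<And>\<delta>. \<delta> \<in> compositions \<Longrightarrow> \<sigma> \<delta> \<in> compositions"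
  shows "tensor_coeff \<beta> \<gamma> (\<Sum>(\<beta>', \<gamma>') | \<beta>' @ \<gamma>' = \<alpha>. M (\<sigma> \<beta>') \<otimes> M (\<sigma> \<gamma>')) \<noteq> 0 \<longleftrightarrow>
    (\<exists>\<beta>' \<gamma>'. \<beta>' @ \<gamma>' = \<alpha> \<and> \<sigma> \<beta>' = \<beta> \<and> \<sigma> \<gamma>' = \<gamma>)"
proof -
  let ?D = "{(\<beta>', \<gamma>'). \<beta>' @ \<gamma>' = \<alpha>}"
  have "tensor_coeff \<beta> \<gamma> (\<Sum>(\<beta>', \<gamma>')\<in>?D. M (\<sigma> \<beta>') \<otimes> M (\<sigma> \<gamma>'))
      = (\<Sum>(\<beta>', \<gamma>')\<in>?D. of_bool (\<sigma> \<beta>' = \<beta> \<and> \<sigma> \<gamma>' = \<gamma>))"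
    unfolding rat_linear_sum[OF rat_linear_tensor_coeff]
  proof (rule sum.cong[OF refl])
    fix p assume "p \<in> ?D"
    then obtain \<beta>' \<gamma>' where p: "p = (\<beta>', \<gamma>')" "\<beta>' @ \<gamma>' = \<alpha>" by auto
    then have "\<beta>' \<in> compositions" "\<gamma>' \<in> compositions" using assms(1) by auto
    then show "tensor_coeff \<beta> \<gamma> (case p of (\<beta>', \<gamma>') \<Rightarrow> M (\<sigma> \<beta>') \<otimes> M (\<sigma> \<gamma>'))
        = (case p of (\<beta>', \<gamma>') \<Rightarrow> of_bool (\<sigma> \<beta>' = \<beta> \<and> \<sigma> \<gamma>' = \<gamma>))"
      using assms(2-4) by (simp add: p(1) tensor_coeff_M)
  qed
  also have "\<dots> \<noteq> 0 \<longleftrightarrow> (\<exists>\<beta>' \<gamma>'. \<beta>' @ \<gamma>' = \<alpha> \<and> \<sigma> \<beta>' = \<beta> \<and> \<sigma> \<gamma>' = \<gamma>)"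
    by (subst sum_nonneg_eq_0_iff) (auto simp: finite_deconcatenations)
  finally show ?thesis .
qed

text \<open>Compatibility with the coproduct, read on basis indices: the deconcatenations of \<open>\<sigma> \<alpha>\<close>
  are the images of those of \<open>\<alpha>\<close>.\<close>

lemma deconcatenation_image:
  assumes "rat_linear \<phi>" "\<And>x. coproduct (\<phi> x) = tensor_map \<phi> \<phi> (coproduct x)"
    and \<sigma>: "\<And>\<delta>. \<delta> \<in> compositions \<Longrightarrow> \<sigma> \<delta> \<in> compositions"
      "\<And>\<delta>. \<delta> \<in> compositions \<Longrightarrow> \<phi> (M \<delta>) = M (\<sigma> \<delta>)"
    and mem: "\<alpha> \<in> compositions" "\<beta> \<in> compositions" "\<gamma> \<in> compositions"
  shows "\<beta> @ \<gamma> = \<sigma> \<alpha> \<longleftrightarrow> (\<exists>\<beta>' \<gamma>'. \<beta>' @ \<gamma>' = \<alpha> \<and> \<sigma> \<beta>' = \<beta> \<and> \<sigma> \<gamma>' = \<gamma>)"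
proof -
  have "coproduct (M (\<sigma> \<alpha>)) = tensor_map \<phi> \<phi> (coproduct (M \<alpha>))"
    using assms(2)[of "M \<alpha>"] \<sigma>(2) mem(1) by simp
  also have "\<dots> = (\<Sum>(\<beta>', \<gamma>') | \<beta>' @ \<gamma>' = \<alpha>. M (\<sigma> \<beta>') \<otimes> M (\<sigma> \<gamma>'))"
    unfolding coproduct_M[OF mem(1)] rat_linear_sum[OF rat_linear_tensor_map[OF assms(1,1)]]
    by (rule sum.cong[OF refl])
      (use mem(1) in \<open>auto simp: tensor_map_tensor assms(1) \<sigma>(2)\<close>)
  finally have "(\<Sum>(\<beta>', \<gamma>') | \<beta>' @ \<gamma>' = \<sigma> \<alpha>. M \<beta>' \<otimes> M \<gamma>')
      = (\<Sum>(\<beta>', \<gamma>') | \<beta>' @ \<gamma>' = \<alpha>. M (\<sigma> \<beta>') \<otimes> M (\<sigma> \<gamma>'))"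
    by (simp add: coproduct_M \<sigma>(1) mem(1))
  then show ?thesis
    using tensor_coeff_deconcatenations[of "\<sigma> \<alpha>" \<beta> \<gamma> "\<lambda>\<delta>. \<delta>"]
      tensor_coeff_deconcatenations[OF mem \<sigma>(1)] mem \<sigma>(1) by simp
qed

text \<open>Size alone determines \<open>\<sigma>\<close> on \<open>[]\<close>, and on one-part compositions once their images are known
  to be indecomposable. Splitting off the first part then determines \<open>\<sigma>\<close> everywhere.\<close>

lemma deconcatenation_map_is_identity:
  assumes \<sigma>: "\<And>\<delta>. \<delta> \<in> compositions \<Longrightarrow> \<sigma> \<delta> \<in> compositions"
      "\<And>\<delta>. \<delta> \<in> compositions \<Longrightarrow> sum_list (\<sigma> \<delta>) = sum_list \<delta>"
    and decon: "\<And>\<alpha> \<beta> \<gamma>. \<alpha> \<in> compositions \<Longrightarrow> \<beta> \<in> compositions \<Longrightarrow> \<gamma> \<in> compositions \<Longrightarrow>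
      \<beta> @ \<gamma> = \<sigma> \<alpha> \<longleftrightarrow> (\<exists>\<beta>' \<gamma>'. \<beta>' @ \<gamma>' = \<alpha> \<and> \<sigma> \<beta>' = \<beta> \<and> \<sigma> \<gamma>' = \<gamma>)"
    and "\<alpha> \<in> compositions"
  shows "\<sigma> \<alpha> = \<alpha>"
proof -
  have Nil: "\<sigma> [] = []"
    using \<sigma>[of "[]"] by (simp add: composition_sum_eq_0)
  have single: "\<sigma> [a] = [a]" if "0 < a" for a
  proof -
    obtain b \<gamma> where b: "\<sigma> [a] = b # \<gamma>"
      using \<sigma>(2)[of "[a]"] \<open>0 < a\<close> by (cases "\<sigma> [a]") auto
    then have mem: "[b] \<in> compositions" "\<gamma> \<in> compositions"
      using \<sigma>(1)[of "[a]"] \<open>0 < a\<close> by auto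
    \<comment> \<open>One piece of the split of \<open>[a]\<close> lying over \<open>[b] @ \<gamma>\<close> is empty, hence so is its image,
      which can only be \<open>\<gamma>\<close>.\<close>
    obtain \<beta>' \<gamma>' where "\<beta>' @ \<gamma>' = [a]" "\<sigma> \<beta>' = [b]" "\<sigma> \<gamma>' = \<gamma>"
      using decon[of "[a]" "[b]" \<gamma>] b mem \<open>0 < a\<close> by auto
    then have "\<gamma> = []" using Nil by (auto simp: append_eq_Cons_conv)
    then show ?thesis using b \<sigma>(2)[of "[a]"] \<open>0 < a\<close> by simp
  qed
  show ?thesis using \<open>\<alpha> \<in> compositions\<close>
  proof (induction \<alpha>)
    case Nil
    show ?case by (fact \<open>\<sigma> [] = []\<close>)
  next
    case (Cons a \<gamma>)
    then have "\<sigma> [a] = [a]" "\<sigma> \<gamma> = \<gamma>" using single by auto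
    then have "[a] @ \<gamma> = \<sigma> (a # \<gamma>)"
      using decon[of "a # \<gamma>" "[a]" \<gamma>] Cons.prems by auto
    then show ?case by simp
  qed
qed

theorem proposition4p6:
  fixes \<phi> :: "qsym \<Rightarrow> qsym"
  assumes "coalgebra_automorphism coproduct counit \<phi>"
    and "graded_map \<phi>"
    and "\<phi> ` (M ` compositions) = M ` compositions"
  shows "\<phi> = id"
proof -
  have lin: "rat_linear \<phi>" and comult: "\<And>x. coproduct (\<phi> x) = tensor_map \<phi> \<phi> (coproduct x)"
    using assms(1) by (auto simp: coalgebra_automorphism_def)
  have "\<forall>\<alpha>\<in>compositions. \<exists>\<beta>. \<beta> \<in> compositions \<and> \<phi> (M \<alpha>) = M \<beta>"
    using assms(3) by blast
  then obtain \<sigma> where \<sigma>: "\<And>\<alpha>. \<alpha> \<in> compositions \<Longrightarrow> \<sigma> \<alpha> \<in> compositions"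
      "\<And>\<alpha>. \<alpha> \<in> compositions \<Longrightarrow> \<phi> (M \<alpha>) = M (\<sigma> \<alpha>)"
    by metis
  have "sum_list (\<sigma> \<alpha>) = sum_list \<alpha>" if "\<alpha> \<in> compositions" for \<alpha>
  proof -
    have "M (\<sigma> \<alpha>) \<in> QSym_n (sum_list \<alpha>)"
      using assms(2) M_in_QSym_n[OF that] \<sigma>(2)[OF that] unfolding graded_map_def by force
    then show ?thesis using M_in_QSym_n_iff \<sigma>(1)[OF that] by simp
  qed
  then have "\<sigma> \<alpha> = \<alpha>" if "\<alpha> \<in> compositions" for \<alpha>
    using deconcatenation_map_is_identity[OF \<sigma>(1) _ deconcatenation_image[OF lin comult \<sigma>]] that
    by blast
  then show ?thesis
    using rat_linear_eq_id_if_fixes_M[OF lin] \<sigma>(2) by simp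
qed

end
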